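(* Let $G$ be a TSI Polish group and $H$ a non-archimedean closed normal subgroup of $G$. If the interval $[0,1]$ embeds (homeomorphically) into $G/H$, then $E(G)\le_B E(G/H)$.
   Context: For a Polish group $G$, $E(G)$ is the equivalence relation on $G^\omega$ given by $x\,E(G)\,y$ iff $(x(n)y(n)^{-1})_n$ converges in $G$. TSI: admits a compatible two-sided invariant metric. Non-archimedean: has a neighborhood base of the identity consisting of open subgroups. $G/H$ carries the quotient topology. $\le_B$ is Borel reducibility. *)

theory Defs
  imports "HOL-Analysis.Analysis" "HOL-Algebra.Coset"
begin

locale topological_group = Group.group G
  for G :: "('a, 'b) monoid_scheme" (structure) +
  fixes T :: "'a topology"
  assumes topspace_eq: "topspace T = carrier G"
    and continuous_mult: "continuous_map (prod_topology T T) T (\<lambda>(x, y). x \<otimes> y)"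
    and continuous_inv: "continuous_map T T (\<lambda>x. inv x)"

locale polish_group = topological_group +
  assumes completely_metrizable: "completely_metrizable_space T"
    and separable: "separable_space T"

locale tsi_polish_group = polish_group +
  assumes two_sided_invariant_metric:
    "\<exists>d. Metric_space (carrier G) d \<and> Metric_space.mtopology (carrier G) d = T \<and>
      (\<forall>g\<in>carrier G. \<forall>h\<in>carrier G. \<forall>x\<in>carrier G. \<forall>y\<in>carrier G.
        d (g \<otimes> x \<otimes> h) (g \<otimes> y \<otimes> h) = d x y)"

locale non_archimedean_group = topological_group +
  assumes open_subgroup_base:
    "neighbourhood_base_at \<one> (\<lambda>V. openin T V \<and> subgroup V G) T"

definition quotient_group_topology ::
    "('a, 'b) monoid_scheme \<Rightarrow> 'a topology \<Rightarrow> 'a set \<Rightarrow> 'a set topology" where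
  "quotient_group_topology G T H =
    topology (\<lambda>U. U \<subseteq> carrier (G Mod H) \<and>
      openin T {x \<in> topspace T. H #>\<^bsub>G\<^esub> x \<in> U})"

lemma openin_quotient_group_topology:
  "openin (quotient_group_topology G T H) U \<longleftrightarrow>
    U \<subseteq> carrier (G Mod H) \<and> openin T {x \<in> topspace T. H #>\<^bsub>G\<^esub> x \<in> U}"
proof -
  have "istopology (\<lambda>U. U \<subseteq> carrier (G Mod H) \<and>
      openin T {x \<in> topspace T. H #>\<^bsub>G\<^esub> x \<in> U})"
    unfolding istopology_def
  proof (intro conjI allI impI; (elim conjE)?)
    fix S U
    assume "openin T {x \<in> topspace T. H #>\<^bsub>G\<^esub> x \<in> S}"
      and "openin T {x \<in> topspace T. H #>\<^bsub>G\<^esub> x \<in> U}"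
    then have "openin T ({x \<in> topspace T. H #>\<^bsub>G\<^esub> x \<in> S} \<inter> {x \<in> topspace T. H #>\<^bsub>G\<^esub> x \<in> U})"
      by (rule openin_Int)
    moreover have "{x \<in> topspace T. H #>\<^bsub>G\<^esub> x \<in> S} \<inter> {x \<in> topspace T. H #>\<^bsub>G\<^esub> x \<in> U} =
        {x \<in> topspace T. H #>\<^bsub>G\<^esub> x \<in> S \<inter> U}"
      by auto
    ultimately show "openin T {x \<in> topspace T. H #>\<^bsub>G\<^esub> x \<in> S \<inter> U}"
      by simp
  next
    fix \<K>
    assume *: "\<forall>K\<in>\<K>. K \<subseteq> carrier (G Mod H) \<and> openin T {x \<in> topspace T. H #>\<^bsub>G\<^esub> x \<in> K}"
    then show "\<Union>\<K> \<subseteq> carrier (G Mod H)"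
      by auto
    have "{x \<in> topspace T. H #>\<^bsub>G\<^esub> x \<in> \<Union>\<K>} = (\<Union>K\<in>\<K>. {x \<in> topspace T. H #>\<^bsub>G\<^esub> x \<in> K})"
      by auto
    with * show "openin T {x \<in> topspace T. H #>\<^bsub>G\<^esub> x \<in> \<Union>\<K>}"
      by (auto intro!: openin_Union)
  qed auto
  then show ?thesis
    unfolding quotient_group_topology_def by (simp add: topology_inverse')
qed

lemma (in topological_group) topspace_quotient_group_topology:
  "topspace (quotient_group_topology G T H) = carrier (G Mod H)"
proof -
  have "{x \<in> topspace T. H #> x \<in> carrier (G Mod H)} = topspace T"
    by (auto simp: carrier_FactGroup topspace_eq)
  then have "openin (quotient_group_topology G T H) (carrier (G Mod H))"
    unfolding openin_quotient_group_topology by simp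
  then show ?thesis
    by (metis openin_quotient_group_topology openin_subset openin_topspace subset_antisym)
qed

lemma (in topological_group) quotient_map_r_coset:
  "quotient_map T (quotient_group_topology G T H) (\<lambda>x. H #> x)"
  unfolding quotient_map_def topspace_quotient_group_topology
  by (auto simp: openin_quotient_group_topology carrier_FactGroup topspace_eq)

definition borel_of_topology :: "'a topology \<Rightarrow> 'a measure" where
  "borel_of_topology X = sigma (topspace X) {U. openin X U}"

definition borel_reducible ::
    "'a topology \<Rightarrow> 'a rel \<Rightarrow> 'b topology \<Rightarrow> 'b rel \<Rightarrow> bool" where
  "borel_reducible X E Y F \<longleftrightarrow>
    (\<exists>\<theta> \<in> borel_of_topology X \<rightarrow>\<^sub>M borel_of_topology Y.
      \<forall>x\<in>topspace X. \<forall>y\<in>topspace X. (x, y) \<in> E \<longleftrightarrow> (\<theta> x, \<theta> y) \<in> F)"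

definition sequence_topology :: "'a topology \<Rightarrow> (nat \<Rightarrow> 'a) topology" where
  "sequence_topology T = product_topology (\<lambda>_. T) UNIV"

definition E_rel :: "('a, 'b) monoid_scheme \<Rightarrow> 'a topology \<Rightarrow> (nat \<Rightarrow> 'a) rel" where
  "E_rel G T = {(x, y). x \<in> topspace (sequence_topology T) \<and> y \<in> topspace (sequence_topology T) \<and>
    (\<exists>l. limitin T (\<lambda>n. x n \<otimes>\<^bsub>G\<^esub> inv\<^bsub>G\<^esub> (y n)) l sequentially)}"

end

theory Submission
  imports Defs
begin

text \<open>
  Fix a two-sided invariant metric \<open>d\<close> on \<open>G\<close>; it is automatically complete. For \<open>x, y \<in> G\<^sup>\<omega>\<close> put
  \<open>z n = x n (y n)\<^sup>-\<^sup>1\<close>. Since \<open>H\<close> has arbitrarily small open subgroups, \<open>z\<close> converges in \<open>G\<close> iff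
  \<open>H z\<close> converges in \<open>G/H\<close> and \<open>d (z n) (z (n+1)) \<rightarrow> 0\<close>. By invariance
  \<open>d (z n) (z (n+1)) = d (u\<^sub>x n) (u\<^sub>y n)\<close> with \<open>u\<^sub>x n = (x (n+1))\<^sup>-\<^sup>1 x n\<close>, so \<open>x\<close> and \<open>y\<close> are decoupled.
  A separable metric space embeds uniformly into \<open>c\<^sub>0\<close> by functions with values in \<open>[0,1]\<close>, hence the
  second condition says that two sequences \<open>t\<^sub>x, t\<^sub>y\<close> in \<open>[0,1]\<close> satisfy \<open>t\<^sub>x - t\<^sub>y \<rightarrow> 0\<close>. Moving \<open>t\<^sub>x\<close> along
  an arc \<open>f\<close> into \<open>G/H\<close>, the sequence interleaving \<open>H x j\<close> with \<open>H x j \<cdot> f (t\<^sub>x j)\<close> is a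
  continuous reduction.
\<close>

section \<open>Uniform embedding of a separable metric space into the space of null sequences\<close>

context Metric_space
begin

text \<open>For a dense sequence \<open>q\<close>, the functions \<open>bump q r i\<close> are uniformly Lipschitz and point-finite in \<open>i\<close>: being
  \<open>r / 2\<close>-close to some \<open>q m\<close> kills all later ones through \<open>avoid\<close>. The first ball \<open>B(q i, r)\<close> containing \<open>u\<close>
  gives a bump that is at least \<open>r / 2\<close> at \<open>u\<close> and vanishes off \<open>B(q i, 2r)\<close>.\<close>
primrec avoid :: "(nat \<Rightarrow> 'a) \<Rightarrow> real \<Rightarrow> nat \<Rightarrow> 'a \<Rightarrow> real" where
  "avoid q r 0 u = r"
| "avoid q r (Suc i) u = min (avoid q r i u) (max 0 (d u (q i) - r / 2))"

definition bump :: "(nat \<Rightarrow> 'a) \<Rightarrow> real \<Rightarrow> nat \<Rightarrow> 'a \<Rightarrow> real" where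
  "bump q r i u = min (avoid q r i u) (max 0 (2 * r - d u (q i)))"

lemma avoid_nonneg: "0 \<le> r \<Longrightarrow> 0 \<le> avoid q r i u"
  by (induction i) auto

lemma avoid_le: "avoid q r i u \<le> r"
  by (induction i) auto

lemma mdist_diff_le: "\<lbrakk>u \<in> M; v \<in> M; p \<in> M\<rbrakk> \<Longrightarrow> \<bar>d u p - d v p\<bar> \<le> d u v"
  by (metis commute mdist_reverse_triangle)

lemma avoid_Lipschitz:
  assumes "range q \<subseteq> M" "u \<in> M" "v \<in> M"
  shows "\<bar>avoid q r i u - avoid q r i v\<bar> \<le> d u v"
proof (induction i)
  case (Suc i)
  have "\<bar>d u (q i) - d v (q i)\<bar> \<le> d u v"
    using assms by (intro mdist_diff_le) auto
  with Suc show ?case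
    unfolding avoid.simps by linarith
qed simp

lemma avoid_eq_0:
  assumes "0 \<le> r" "d u (q m) < r / 2" "m < i"
  shows "avoid q r i u = 0"
  using \<open>m < i\<close>
proof (induction i)
  case (Suc i)
  have "0 \<le> avoid q r i u"
    using assms by (simp add: avoid_nonneg)
  with Suc assms(2) show ?case
    by (cases "m = i") auto
qed simp

lemma avoid_ge:
  assumes "0 \<le> r" "\<And>j. j < i \<Longrightarrow> r \<le> d u (q j)"
  shows "r / 2 \<le> avoid q r i u"
  using assms(2)
proof (induction i)
  case (Suc i)
  have "r / 2 \<le> avoid q r i u" "r \<le> d u (q i)"
    using Suc by auto
  then show ?case
    unfolding avoid.simps by linarith
qed (use assms in auto)

lemma bump_nonneg: "0 \<le> r \<Longrightarrow> 0 \<le> bump q r i u"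
  by (simp add: bump_def avoid_nonneg)

lemma bump_le: "bump q r i u \<le> r"
  using avoid_le[of q r i u] by (simp add: bump_def min_le_iff_disj)

lemma bump_Lipschitz:
  assumes "range q \<subseteq> M" "u \<in> M" "v \<in> M"
  shows "\<bar>bump q r i u - bump q r i v\<bar> \<le> d u v"
proof -
  have "\<bar>d u (q i) - d v (q i)\<bar> \<le> d u v"
    using assms by (intro mdist_diff_le) auto
  with avoid_Lipschitz[OF assms, of r i] show ?thesis
    unfolding bump_def by linarith
qed

lemma bump_eq_0:
  assumes "0 \<le> r" "d u (q m) < r / 2" "m < i"
  shows "bump q r i u = 0"
  using avoid_eq_0[of r u q m i, OF assms] by (simp add: bump_def)

lemma bump_separates:
  assumes q: "range q \<subseteq> M" and "u \<in> M" "v \<in> M" "0 < r"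
    and near: "d u (q m) < r" and far: "3 * r \<le> d u v"
  shows "\<exists>i. r / 2 \<le> \<bar>bump q r i u - bump q r i v\<bar>"
proof -
  define i where "i = (LEAST i. d u (q i) < r)"
  have i: "d u (q i) < r"
    unfolding i_def using near by (rule LeastI)
  have "r \<le> d u (q j)" if "j < i" for j
    using not_less_Least that unfolding i_def by fastforce
  then have "r / 2 \<le> avoid q r i u"
    using \<open>0 < r\<close> by (intro avoid_ge) auto
  with i have 1: "r / 2 \<le> bump q r i u"
    using \<open>0 < r\<close> by (auto simp: bump_def)
  \<comment> \<open>\<open>far\<close> puts \<open>v\<close> at distance more than
    \<open>2 * r\<close> from \<open>q i\<close>, where the second argument of the
    \<open>min\<close> in \<open>bump\<close> is zero.\<close>
  have "d u v \<le> d u (q i) + d v (q i)"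
    using assms by (intro triangle') auto
  then have "bump q r i v = 0"
    using far i avoid_nonneg[of r q i v] \<open>0 < r\<close> by (simp add: bump_def)
  with 1 show ?thesis
    by (metis abs_ge_self diff_zero order_trans)
qed

text \<open>The bumps of all scales \<open>(1/2) ^ k\<close> are evaluated at all terms and listed
  as one sequence. Gaps \<open>d (u n) (v n)\<close> that do not tend to zero are seen infinitely
  often at one fixed scale. Conversely, if the gaps tend to zero, late \<open>n\<close> are
  controlled by the Lipschitz bound, large \<open>k\<close> by the height of the bumps, and for each
  remaining pair only finitely many bumps are nonzero. The Lipschitz clause also supplies continuity
  of the coding.\<close>

lemma c0_coding:
  assumes "separable_space mtopology"
  obtains \<nu> :: "nat \<Rightarrow> nat" and \<Phi> :: "nat \<Rightarrow> 'a \<Rightarrow> real"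
  where "\<And>j u. \<Phi> j u \<in> {0..1}"
    and "\<And>j u v. \<lbrakk>u \<in> M; v \<in> M\<rbrakk> \<Longrightarrow> \<bar>\<Phi> j u - \<Phi> j v\<bar> \<le> d u v"
    and "\<And>u v. \<lbrakk>range u \<subseteq> M; range v \<subseteq> M\<rbrakk> \<Longrightarrow>
      ((\<lambda>j. \<Phi> j (u (\<nu> j)) - \<Phi> j (v (\<nu> j))) \<longlonglongrightarrow> 0) \<longleftrightarrow> ((\<lambda>n. d (u n) (v n)) \<longlonglongrightarrow> 0)"
proof (cases "M = {}")
  case True
  \<comment> \<open>\<open>range u\<close> is never empty, so the third property holds
    vacuously.\<close>
  then show ?thesis
    by (intro that[of "\<lambda>_ _. 0"]) auto
next
  case False
  obtain C where C: "countable C" "C \<subseteq> M" "mtopology closure_of C = M"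
    using assms by (auto simp: separable_space_def)
  with False have "C \<noteq> {}" by auto
  define q where "q = from_nat_into C"
  have rq: "range q = C"
    using C \<open>C \<noteq> {}\<close> by (simp add: q_def range_from_nat_into)
  then have q: "range q \<subseteq> M" using C by simp
  have dense: "\<exists>m. d u (q m) < r" if "u \<in> M" "0 < r" for u r
    using C(3) that rq unfolding metric_closure_of by fastforce
  \<comment> \<open>The index \<open>j\<close> codes a position in the sequence, a scale and a bump
    number, in this order; \<open>ix\<close> is the inverse coding.\<close>
  define \<nu> where "\<nu> j = fst (prod_decode j)" for j
  define \<kappa> where "\<kappa> j = fst (prod_decode (snd (prod_decode j)))" for j
  define \<iota> where "\<iota> j = snd (prod_decode (snd (prod_decode j)))" for j
  define ix where "ix n k i = prod_encode (n, prod_encode (k, i))" for n k i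
  have ix [simp]: "\<nu> (ix n k i) = n" "\<kappa> (ix n k i) = k" "\<iota> (ix n k i) = i" for n k i
    by (simp_all add: \<nu>_def \<kappa>_def \<iota>_def ix_def)
  have ix_eq: "j = ix (\<nu> j) (\<kappa> j) (\<iota> j)" for j
    by (simp add: \<nu>_def \<kappa>_def \<iota>_def ix_def)
  \<comment> \<open>The code dominates the position, so a bound valid for late codes applies to
    every late \<open>n\<close>, whatever \<open>k\<close> and \<open>i\<close> are.\<close>
  have n_le: "n \<le> ix n k i" for n k i
    by (simp add: ix_def le_prod_encode_1)
  define \<Phi> where "\<Phi> j = bump q ((1/2) ^ \<kappa> j) (\<iota> j)" for j
  have nonneg': "0 \<le> \<Phi> j u" and le: "\<Phi> j u \<le> (1/2) ^ \<kappa> j" for j u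
    by (auto simp: \<Phi>_def bump_nonneg bump_le)
  have Lip: "\<bar>\<Phi> j u - \<Phi> j v\<bar> \<le> d u v" if "u \<in> M" "v \<in> M" for j u v
    using that q by (simp add: \<Phi>_def bump_Lipschitz)
  show ?thesis
  proof (rule that[of \<Phi> \<nu>])
    show "\<Phi> j u \<in> {0..1}" for j u
      using nonneg'[of j u] le[of j u] power_le_one[of "1/2::real" "\<kappa> j"] by simp
    show "\<bar>\<Phi> j u - \<Phi> j v\<bar> \<le> d u v" if "u \<in> M" "v \<in> M" for j u v
      using that by (rule Lip)
    fix u v :: "nat \<Rightarrow> 'a"
    assume uv: "range u \<subseteq> M" "range v \<subseteq> M"
    then have uM [simp]: "u n \<in> M" and vM [simp]: "v n \<in> M" for n by auto
    show "((\<lambda>j. \<Phi> j (u (\<nu> j)) - \<Phi> j (v (\<nu> j))) \<longlonglongrightarrow> 0) \<longleftrightarrow> ((\<lambda>n. d (u n) (v n)) \<longlonglongrightarrow> 0)"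
    proof
      assume L: "(\<lambda>j. \<Phi> j (u (\<nu> j)) - \<Phi> j (v (\<nu> j))) \<longlonglongrightarrow> 0"
      show "(\<lambda>n. d (u n) (v n)) \<longlonglongrightarrow> 0"
      proof (rule LIMSEQ_I)
        fix e :: real assume "0 < e"
        \<comment> \<open>With this scale \<open>3 * (1/2) ^ k < e\<close>, so a gap of at least
          \<open>e\<close> is far in the sense of \<open>bump_separates\<close>.\<close>
        then obtain k where k: "(1/2::real) ^ k < e / 3"
          using real_arch_pow_inv[of "e/3" "1/2"] by auto
        obtain N where N: "\<And>j. j \<ge> N \<Longrightarrow> \<bar>\<Phi> j (u (\<nu> j)) - \<Phi> j (v (\<nu> j))\<bar> < (1/2) ^ k / 2"
          using LIMSEQ_D[OF L, of "(1/2) ^ k / 2"] by auto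
        have "d (u n) (v n) < e" if "n \<ge> N" for n
        proof (rule ccontr)
          assume "\<not> d (u n) (v n) < e"
          with k have far: "3 * (1/2) ^ k \<le> d (u n) (v n)" by simp
          obtain m where "d (u n) (q m) < (1/2) ^ k"
            using dense[of "u n" "(1/2) ^ k"] by auto
          then obtain i where i: "(1/2) ^ k / 2 \<le> \<bar>bump q ((1/2) ^ k) i (u n) - bump q ((1/2) ^ k) i (v n)\<bar>"
            using bump_separates[of q "u n" "v n" "(1/2) ^ k" m] q far by auto
          have "N \<le> ix n k i"
            using n_le[of n k i] that by simp
          from N[OF this] i show False
            by (simp add: \<Phi>_def)
        qed
        then show "\<exists>N. \<forall>n\<ge>N. norm (d (u n) (v n) - 0) < e"
          by auto
      qed
    next
      assume R: "(\<lambda>n. d (u n) (v n)) \<longlonglongrightarrow> 0"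
      show "(\<lambda>j. \<Phi> j (u (\<nu> j)) - \<Phi> j (v (\<nu> j))) \<longlonglongrightarrow> 0"
      proof (rule LIMSEQ_I)
        fix e :: real assume "0 < e"
        obtain N where N: "\<And>n. n \<ge> N \<Longrightarrow> d (u n) (v n) < e"
          using LIMSEQ_D[OF R \<open>0 < e\<close>] by auto
        obtain K where K: "(1/2::real) ^ K < e"
          using real_arch_pow_inv[of e "1/2"] \<open>0 < e\<close> by auto
        define Z where "Z n k i \<longleftrightarrow> bump q ((1/2) ^ k) i (u n) = 0 \<and> bump q ((1/2) ^ k) i (v n) = 0"
          for n k i
        \<comment> \<open>Density gives \<open>q a\<close> and \<open>q b\<close> within half the
          scale of \<open>u n\<close> and \<open>v n\<close>; all later bumps vanish at both
          points.\<close>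
        have "\<exists>m. \<forall>i>m. Z n k i" for n k
        proof -
          obtain a b where "d (u n) (q a) < (1/2) ^ k / 2" "d (v n) (q b) < (1/2) ^ k / 2"
            using dense[of "u n" "(1/2) ^ k / 2"] dense[of "v n" "(1/2) ^ k / 2"] by auto
          then have "\<forall>i>max a b. Z n k i"
            using bump_eq_0[of "(1/2) ^ k" "u n" q a] bump_eq_0[of "(1/2) ^ k" "v n" q b]
            by (auto simp: Z_def)
          then show ?thesis ..
        qed
        then obtain m where m: "\<And>n k i. i > m n k \<Longrightarrow> Z n k i"
          by metis
        \<comment> \<open>The finitely many codes that escape all three estimates: early position,
          coarse scale, and a bump that may still be nonzero.\<close>
        define A where "A = (\<Union>n<N. \<Union>k<K. ix n k ` {..m n k})"
        have "finite A" by (auto simp: A_def)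
        then obtain J where J: "\<And>j. j \<in> A \<Longrightarrow> j < J"
          unfolding finite_nat_set_iff_bounded by auto
        have "\<bar>\<Phi> j (u (\<nu> j)) - \<Phi> j (v (\<nu> j))\<bar> < e" if "j \<ge> J" for j
        proof -
          have "ix (\<nu> j) (\<kappa> j) (\<iota> j) \<notin> A"
            using J that ix_eq[of j] by (metis leD)
          moreover have "ix n k i \<in> A" if "n < N" "k < K" "i \<le> m n k" for n k i
            unfolding A_def using that by blast
          ultimately consider "\<nu> j \<ge> N" | "\<kappa> j \<ge> K" | "\<iota> j > m (\<nu> j) (\<kappa> j)"
            using not_le by blast
          then show ?thesis
          proof cases
            case 1
            then show ?thesis
              using Lip[of "u (\<nu> j)" "v (\<nu> j)" j] N[of "\<nu> j"] by simp
          next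
            case 2
            then have "(1/2::real) ^ \<kappa> j \<le> (1/2) ^ K"
              by (intro power_decreasing) auto
            with K have "\<Phi> j w < e" for w
              using le[of j w] by linarith
            from this[of "u (\<nu> j)"] this[of "v (\<nu> j)"] show ?thesis
              using nonneg'[of j "u (\<nu> j)"] nonneg'[of j "v (\<nu> j)"] by linarith
          next
            case 3
            then show ?thesis
              using m[OF 3] \<open>0 < e\<close> by (simp add: \<Phi>_def Z_def)
          qed
        qed
        then show "\<exists>J. \<forall>j\<ge>J. norm (\<Phi> j (u (\<nu> j)) - \<Phi> j (v (\<nu> j)) - 0) < e"
          by auto
      qed
    qed
  qed
qed

section \<open>Injective paths in a metric space\<close>

lemma continuous_map_mdist_fun:
  assumes "continuous_map X mtopology f" "continuous_map X mtopology g"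
  shows "continuous_map X euclidean (\<lambda>x. d (f x) (g x))"
  using continuous_map_mdist[of X "metric (M, d)" f g] assms
  by (simp add: mtopology_of mspace_metric mdist_metric)

text \<open>By compactness of \<open>[0,1]\<close>, an injective path is a uniform homeomorphism
  onto its image: the function \<open>h\<close> on the square is uniformly continuous, vanishes on
  the diagonal and is bounded below by a positive constant away from it.\<close>

lemma arc_mdist_tendsto_0_iff:
  fixes a b :: "nat \<Rightarrow> real"
  assumes f: "continuous_map (top_of_set {0..1}) mtopology f" and inj: "inj_on f {0..1}"
    and ab: "range a \<subseteq> {0..1}" "range b \<subseteq> {0..1}"
  shows "((\<lambda>j. d (f (a j)) (f (b j))) \<longlonglongrightarrow> 0) \<longleftrightarrow> ((\<lambda>j. a j - b j) \<longlonglongrightarrow> 0)"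
proof -
  define Q where "Q = {0..1::real} \<times> {0..1::real}"
  define h where "h p = d (f (fst p)) (f (snd p))" for p
  have fM: "f t \<in> M" if "t \<in> {0..1}" for t
    using f that by (auto simp: continuous_map_def)
  have pr: "continuous_map (top_of_set Q) (top_of_set {0..1}) fst"
    "continuous_map (top_of_set Q) (top_of_set {0..1}) snd"
    by (auto simp: Q_def intro!: continuous_intros)
  have "continuous_map (top_of_set Q) mtopology (f \<circ> fst)"
    "continuous_map (top_of_set Q) mtopology (f \<circ> snd)"
    using pr f by (blast intro: continuous_map_compose)+
  from continuous_map_mdist_fun[OF this] have h: "continuous_on Q h"
    by (simp add: h_def o_def)
  have Q: "compact Q"
    unfolding Q_def by (intro compact_Times compact_Icc)
  have abI: "a j \<in> {0..1}" "b j \<in> {0..1}" for j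
    using ab by (auto simp: image_subset_iff)
  show ?thesis
  proof
    assume L: "(\<lambda>j. d (f (a j)) (f (b j))) \<longlonglongrightarrow> 0"
    show "(\<lambda>j. a j - b j) \<longlonglongrightarrow> 0"
    proof (rule LIMSEQ_I)
      fix e :: real assume "0 < e"
      define R where "R = Q \<inter> {p. e \<le> \<bar>fst p - snd p\<bar>}"
      have "closed {p::real\<times>real. e \<le> \<bar>fst p - snd p\<bar>}"
        by (intro closed_Collect_le continuous_intros)
      then have R: "compact R"
        unfolding R_def using Q by (rule compact_Int_closed[rotated])
      \<comment> \<open>Injectivity makes \<open>h\<close> positive off the diagonal, so its minimum
        over the compact set \<open>R\<close> is positive; for empty \<open>R\<close> any positive
        number serves.\<close>
      have "\<exists>\<delta>>0. \<forall>p\<in>R. \<delta> \<le> h p"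
      proof (cases "R = {}")
        case True
        then show ?thesis by (intro exI[of _ 1]) auto
      next
        case False
        have "continuous_on R h"
          using h by (rule continuous_on_subset) (auto simp: R_def)
        from continuous_attains_inf[OF R False this]
        obtain p where p: "p \<in> R" "\<And>p'. p' \<in> R \<Longrightarrow> h p \<le> h p'" by auto
        have "fst p \<noteq> snd p" "fst p \<in> {0..1}" "snd p \<in> {0..1}"
          using p(1) \<open>0 < e\<close> by (auto simp: R_def Q_def)
        then have "0 < h p"
          unfolding h_def using fM inj by (subst mdist_pos_eq) (auto dest: inj_onD)
        with p show ?thesis by blast
      qed
      then obtain \<delta> where \<delta>: "0 < \<delta>" "\<And>p. p \<in> R \<Longrightarrow> \<delta> \<le> h p" by blast
      obtain N where N: "\<And>j. j \<ge> N \<Longrightarrow> d (f (a j)) (f (b j)) < \<delta>"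
        using LIMSEQ_D[OF L \<delta>(1)] by auto
      have "\<bar>a j - b j\<bar> < e" if "j \<ge> N" for j
        using N[OF that] \<delta>(2)[of "(a j, b j)"] abI[of j] by (force simp: h_def R_def Q_def)
      then show "\<exists>N. \<forall>j\<ge>N. norm (a j - b j - 0) < e"
        by auto
    qed
  next
    assume R: "(\<lambda>j. a j - b j) \<longlonglongrightarrow> 0"
    have "uniformly_continuous_on Q h"
      using h Q by (rule compact_uniformly_continuous)
    \<comment> \<open>Each pair is compared with the diagonal point \<open>(a j, a j)\<close>, where
      \<open>h\<close> is zero.\<close>
    moreover have "(\<lambda>j. dist (a j, b j) (a j, a j)) \<longlonglongrightarrow> 0"
      using tendsto_norm[OF R] by (simp add: dist_Pair_Pair dist_real_def abs_minus_commute)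
    moreover have "\<forall>j. (a j, b j) \<in> Q" "\<forall>j. (a j, a j) \<in> Q"
      using abI by (auto simp: Q_def)
    ultimately have "(\<lambda>j. dist (h (a j, b j)) (h (a j, a j))) \<longlonglongrightarrow> 0"
      unfolding uniformly_continuous_on_sequentially
      by (elim allE[of _ "\<lambda>j. (a j, b j)"] allE[of _ "\<lambda>j. (a j, a j)"]) blast
    then show "(\<lambda>j. d (f (a j)) (f (b j))) \<longlonglongrightarrow> 0"
      using fM[OF abI(1)] by (simp add: h_def)
  qed
qed

end

section \<open>Groups with a two-sided invariant metric\<close>

text \<open>Continuity of multiplication and inversion follows from invariance. The same setting
  therefore covers both \<open>G\<close> and the quotient with its coset metric.\<close>

locale invariant_metric_group = Group.group G + Metric_space "carrier G" d
  for G :: "('a, 'b) monoid_scheme" (structure) and d :: "'a \<Rightarrow> 'a \<Rightarrow> real" +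
  assumes left_invariant:
      "\<lbrakk>g \<in> carrier G; x \<in> carrier G; y \<in> carrier G\<rbrakk> \<Longrightarrow> d (g \<otimes> x) (g \<otimes> y) = d x y"
    and right_invariant:
      "\<lbrakk>g \<in> carrier G; x \<in> carrier G; y \<in> carrier G\<rbrakk> \<Longrightarrow> d (x \<otimes> g) (y \<otimes> g) = d x y"
begin

lemma dist_mult_le:
  assumes "x \<in> carrier G" "x' \<in> carrier G" "y \<in> carrier G" "y' \<in> carrier G"
  shows "d (x \<otimes> y) (x' \<otimes> y') \<le> d x x' + d y y'"
  using triangle[of "x \<otimes> y" "x' \<otimes> y" "x' \<otimes> y'"] assms
  by (simp add: left_invariant right_invariant)

lemma dist_inv:
  assumes "x \<in> carrier G" "y \<in> carrier G"
  shows "d (inv x) (inv y) = d x y"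
proof -
  have "d (inv x) (inv y) = d (x \<otimes> inv x \<otimes> y) (x \<otimes> inv y \<otimes> y)"
    using assms by (simp only: left_invariant right_invariant inv_closed m_closed)
  also have "\<dots> = d y x"
    using assms by (simp add: m_assoc)
  finally show ?thesis by (simp add: commute)
qed

lemma dist_div_one:
  assumes "x \<in> carrier G" "y \<in> carrier G"
  shows "d (x \<otimes> inv y) \<one> = d x y"
  using right_invariant[of "inv y" x y] assms by simp

text \<open>Multiplying by \<open>inv x'\<close> on the left and by \<open>y\<close> on the right
  separates the variables: one argument then involves only \<open>x\<close> and \<open>x'\<close>,
  the other only \<open>y\<close> and \<open>y'\<close>. This decouples the two sequences in the
  reduction.\<close>

lemma dist_div_div:
  assumes "x \<in> carrier G" "y \<in> carrier G" "x' \<in> carrier G" "y' \<in> carrier G"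
  shows "d (x \<otimes> inv y) (x' \<otimes> inv y') = d (inv x' \<otimes> x) (inv y' \<otimes> y)"
proof -
  have "d (x \<otimes> inv y) (x' \<otimes> inv y') = d (inv x' \<otimes> (x \<otimes> inv y) \<otimes> y) (inv x' \<otimes> (x' \<otimes> inv y') \<otimes> y)"
    using assms by (simp add: left_invariant right_invariant)
  also have "inv x' \<otimes> (x \<otimes> inv y) \<otimes> y = inv x' \<otimes> x"
    using assms by (simp add: m_assoc)
  also have "inv x' \<otimes> (x' \<otimes> inv y') \<otimes> y = inv y' \<otimes> y"
    using assms by (simp add: m_assoc[symmetric])
  finally show ?thesis .
qed

lemma continuous_map_mult:
  assumes "continuous_map X mtopology f" "continuous_map X mtopology g"
  shows "continuous_map X mtopology (\<lambda>x. f x \<otimes> g x)"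
  unfolding continuous_map_to_metric
proof (intro ballI allI impI)
  fix x and e :: real
  assume x: "x \<in> topspace X" "0 < e"
  obtain U where U: "openin X U" "x \<in> U" "\<And>y. y \<in> U \<Longrightarrow> f y \<in> mball (f x) (e/2)"
    using assms(1) x unfolding continuous_map_to_metric by (metis half_gt_zero)
  obtain V where V: "openin X V" "x \<in> V" "\<And>y. y \<in> V \<Longrightarrow> g y \<in> mball (g x) (e/2)"
    using assms(2) x unfolding continuous_map_to_metric by (metis half_gt_zero)
  show "\<exists>W. openin X W \<and> x \<in> W \<and> (\<forall>y\<in>W. f y \<otimes> g y \<in> mball (f x \<otimes> g x) e)"
  proof (intro exI conjI ballI)
    show "openin X (U \<inter> V)" "x \<in> U \<inter> V"
      using U V by auto
    fix y assume y: "y \<in> U \<inter> V"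
    then show "f y \<otimes> g y \<in> mball (f x \<otimes> g x) e"
      using U(3)[of y] V(3)[of y] dist_mult_le[of "f x" "f y" "g x" "g y"] by auto
  qed
qed

lemma continuous_map_inverse:
  assumes "continuous_map X mtopology f"
  shows "continuous_map X mtopology (\<lambda>x. inv (f x))"
  unfolding continuous_map_to_metric
proof (intro ballI allI impI)
  fix x and e :: real
  assume x: "x \<in> topspace X" "0 < e"
  obtain U where U: "openin X U" "x \<in> U" "\<And>y. y \<in> U \<Longrightarrow> f y \<in> mball (f x) e"
    using assms(1) x unfolding continuous_map_to_metric by metis
  then show "\<exists>U. openin X U \<and> x \<in> U \<and> (\<forall>y\<in>U. inv (f y) \<in> mball (inv (f x)) e)"
    by (intro exI[of _ U]) (auto simp: dist_inv)
qed

text \<open>The elements \<open>g\<close> such that the translated Cauchy sequence \<open>g \<otimes> x n\<close> is eventually \<open>\<rho>\<close>-small at scale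
  \<open>1 / k\<close> form a dense open set for every \<open>k\<close>; Baire's theorem yields a \<open>g\<close> for which the translate,
  and hence the sequence itself, converges.\<close>
lemma completely_metrizable_imp_mcomplete:
  assumes "completely_metrizable_space mtopology"
  shows "mcomplete"
  unfolding mcomplete_def
proof (intro allI impI)
  fix x assume x: "MCauchy x"
  obtain M' \<rho> where M': "Metric_space M' \<rho>" "Metric_space.mcomplete M' \<rho>"
      "mtopology = Metric_space.mtopology M' \<rho>"
    using assms unfolding completely_metrizable_space_def by blast
  have "M' = carrier G"
    using M' by (metis Metric_space.topspace_mtopology topspace_mtopology)
  with M' interpret R: Metric_space "carrier G" \<rho> by simp
  have R: R.mcomplete "mtopology = R.mtopology"
    using M' \<open>M' = carrier G\<close> by simp_all
  have xG [simp]: "x n \<in> carrier G" for n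
    using x by (auto simp: MCauchy_def)
  have Cau: "\<exists>N. \<forall>m n. N \<le> m \<longrightarrow> N \<le> n \<longrightarrow> d (x m) (x n) < e" if "0 < e" for e
    using x that by (simp add: MCauchy_def)
  \<comment> \<open>Both metrics induce the same topology, so a \<open>\<rho>\<close>-ball contains
    a \<open>d\<close>-ball around its centre.\<close>
  have small: "\<exists>\<delta>>0. \<forall>w\<in>mball p \<delta>. \<rho> p w < e" if "p \<in> carrier G" "0 < e" for p e
  proof -
    have "openin mtopology (R.mball p e)"
      unfolding R(2) by (rule R.openin_mball)
    moreover have "p \<in> R.mball p e" using that by simp
    ultimately obtain \<delta> where "0 < \<delta>" "mball p \<delta> \<subseteq> R.mball p e"
      unfolding openin_mtopology by blast
    then show ?thesis by (intro exI[of _ \<delta>]) (auto simp: subset_iff)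
  qed
  \<comment> \<open>The tail stays within \<open>\<delta>\<close> of \<open>x N\<close>, while the
    ball has radius \<open>2 * \<delta>\<close>; the slack allows \<open>g\<close> to be
    perturbed.\<close>
  define O' where "O' k = {g \<in> carrier G. \<exists>N \<delta>. 0 < \<delta> \<and> (\<forall>m\<ge>N. d (x m) (x N) < \<delta>) \<and>
      (\<exists>p\<in>carrier G. \<forall>w\<in>mball (g \<otimes> x N) (2 * \<delta>). \<rho> p w < inverse (Suc k))}" for k :: nat
  have opn: "openin mtopology (O' k)" for k
    unfolding openin_mtopology
  proof (intro conjI allI impI)
    show "O' k \<subseteq> carrier G" by (auto simp: O'_def)
    fix g assume "g \<in> O' k"
    then obtain N \<delta> p where g: "g \<in> carrier G" "0 < \<delta>" "\<And>m. m \<ge> N \<Longrightarrow> d (x m) (x N) < \<delta>"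
      "p \<in> carrier G" "\<And>w. w \<in> mball (g \<otimes> x N) (2 * \<delta>) \<Longrightarrow> \<rho> p w < inverse (Suc k)"
      unfolding O'_def by blast
    obtain N1 where N1: "\<And>m n. \<lbrakk>m \<ge> N1; n \<ge> N1\<rbrakk> \<Longrightarrow> d (x m) (x n) < \<delta> / 4"
      using Cau[of "\<delta>/4"] g(2) by auto
    define N' where "N' = max N N1"
    have "mball g (\<delta>/2) \<subseteq> O' k"
    proof
      fix g' assume g': "g' \<in> mball g (\<delta>/2)"
      \<comment> \<open>The centre moves by at most \<open>\<delta>/2\<close> on account of
        \<open>g'\<close> and \<open>\<delta>\<close> on account of the sequence, which leaves
        radius \<open>\<delta>/2\<close>.\<close>
      have "mball (g' \<otimes> x N') (2 * (\<delta>/4)) \<subseteq> mball (g \<otimes> x N) (2 * \<delta>)"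
      proof (rule mball_subset)
        have "d (g' \<otimes> x N') (g \<otimes> x N) \<le> d g' g + d (x N') (x N)"
          using g g' by (intro dist_mult_le) auto
        also have "\<dots> < \<delta>/2 + \<delta>"
          using g' g(3)[of N'] by (simp add: commute N'_def)
        finally show "d (g' \<otimes> x N') (g \<otimes> x N) + 2 * (\<delta>/4) \<le> 2 * \<delta>"
          by simp
      qed (use g in simp)
      then have "\<forall>w\<in>mball (g' \<otimes> x N') (2 * (\<delta>/4)). \<rho> p w < inverse (Suc k)"
        using g(5) by blast
      moreover have "\<forall>m\<ge>N'. d (x m) (x N') < \<delta>/4"
        using N1 by (simp add: N'_def)
      moreover have "0 < \<delta>/4" "g' \<in> carrier G"
        using g g' by auto
      ultimately show "g' \<in> O' k"
        unfolding O'_def using g(4) by blast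
    qed
    then show "\<exists>r>0. mball g r \<subseteq> O' k"
      using g(2) by (intro exI[of _ "\<delta>/2"]) auto
  qed
  have dns: "mtopology closure_of (O' k) = carrier G" for k
  proof -
    have "\<exists>g\<in>O' k. g \<in> mball g0 \<eta>" if g0: "g0 \<in> carrier G" "0 < \<eta>" for g0 \<eta>
    proof -
      obtain N where N: "\<And>m n. \<lbrakk>m \<ge> N; n \<ge> N\<rbrakk> \<Longrightarrow> d (x m) (x n) < \<eta>"
        using Cau[OF g0(2)] by auto
      define p where "p = g0 \<otimes> x N"
      have p: "p \<in> carrier G" using g0 by (simp add: p_def)
      obtain \<delta> where \<delta>: "0 < \<delta>" "\<And>w. w \<in> mball p \<delta> \<Longrightarrow> \<rho> p w < inverse (Suc k)"
        using small[OF p, of "inverse (Suc k)"] by auto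
      obtain N1 where N1: "\<And>m n. \<lbrakk>m \<ge> N1; n \<ge> N1\<rbrakk> \<Longrightarrow> d (x m) (x n) < \<delta> / 2"
        using Cau[of "\<delta>/2"] \<delta>(1) by auto
      define N' where "N' = max N N1"
      \<comment> \<open>This \<open>g\<close> puts the translate of \<open>x N'\<close> exactly at
        \<open>p\<close>. By invariance its distance from \<open>g0\<close> is that from
        \<open>x N'\<close> to \<open>x N\<close>, hence below \<open>\<eta>\<close>.\<close>
      define g where "g = p \<otimes> inv (x N')"
      have g: "g \<in> carrier G" "g \<otimes> x N' = p"
        using p by (auto simp: g_def m_assoc)
      have "d g0 g = d (g0 \<otimes> x N') p"
        using right_invariant[of "x N'" g0 g] g g0 by simp
      also have "\<dots> < \<eta>"
        unfolding p_def using g0 N[of N' N] by (simp add: left_invariant N'_def)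
      finally have "g \<in> mball g0 \<eta>" using g g0 by simp
      moreover have "g \<in> O' k"
        unfolding O'_def
      proof (intro CollectI conjI exI bexI[OF _ p] ballI)
        show "0 < \<delta>/2" using \<delta> by simp
        show "\<forall>m\<ge>N'. d (x m) (x N') < \<delta>/2"
          using N1 by (simp add: N'_def)
        show "\<rho> p w < inverse (Suc k)" if "w \<in> mball (g \<otimes> x N') (2 * (\<delta>/2))" for w
          using that g(2) \<delta>(2)[of w] by simp
      qed fact
      ultimately show ?thesis by blast
    qed
    then show ?thesis
      by (auto simp: metric_closure_of)
  qed
  have "mtopology closure_of \<Inter> (range O') = carrier G"
    using Baire_category[of mtopology "range O'"] assms opn dns by auto
  then have "\<Inter> (range O') \<noteq> {}"
    using one_closed by (metis closure_of_empty empty_iff)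
  then obtain g where g: "\<And>k. g \<in> O' k" by auto
  then have gG: "g \<in> carrier G" by (auto simp: O'_def)
  have "R.MCauchy (\<lambda>n. g \<otimes> x n)"
    unfolding R.MCauchy_def
  proof (intro conjI allI impI)
    show "range (\<lambda>n. g \<otimes> x n) \<subseteq> carrier G" using gG by auto
    fix e :: real assume "0 < e"
    then obtain k where k: "inverse (Suc k) < e / 2"
      using reals_Archimedean[of "e/2"] by auto
    from g[of k] obtain N \<delta> p where N: "0 < \<delta>" "\<And>m. m \<ge> N \<Longrightarrow> d (x m) (x N) < \<delta>"
      "p \<in> carrier G" "\<And>w. w \<in> mball (g \<otimes> x N) (2 * \<delta>) \<Longrightarrow> \<rho> p w < inverse (Suc k)"
      unfolding O'_def by blast
    have half: "\<rho> p (g \<otimes> x n) < e / 2" if "n \<ge> N" for n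
    proof -
      have "g \<otimes> x n \<in> mball (g \<otimes> x N) (2 * \<delta>)"
        using N(1) N(2)[OF that] gG by (simp add: left_invariant commute)
      from N(4)[OF this] k show ?thesis by simp
    qed
    have "\<rho> (g \<otimes> x n) (g \<otimes> x n') < e" if "n \<ge> N" "n' \<ge> N" for n n'
      using half[OF that(1)] half[OF that(2)] R.triangle''[of "g \<otimes> x n" p "g \<otimes> x n'"] N(3) gG
      by simp
    then show "\<exists>N. \<forall>n n'. N \<le> n \<longrightarrow> N \<le> n' \<longrightarrow> \<rho> (g \<otimes> x n) (g \<otimes> x n') < e"
      by blast
  qed
  then obtain l where "limitin R.mtopology (\<lambda>n. g \<otimes> x n) l sequentially"
    using R(1) unfolding R.mcomplete_def by blast
  then have l: "l \<in> carrier G" "(\<lambda>n. d (g \<otimes> x n) l) \<longlonglongrightarrow> 0"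
    unfolding R(2)[symmetric] limitin_metric_dist_null by auto
  \<comment> \<open>Left translation by \<open>inv g\<close> is a \<open>d\<close>-isometry, so the
    limit of the translate pulls back to one of \<open>x\<close>.\<close>
  have "d (x n) (inv g \<otimes> l) = d (g \<otimes> x n) l" for n
    using left_invariant[of g "x n" "inv g \<otimes> l"] gG l by (simp add: m_assoc[symmetric])
  with l gG have "limitin mtopology x (inv g \<otimes> l) sequentially"
    unfolding limitin_metric_dist_null by simp
  then show "\<exists>l. limitin mtopology x l sequentially" ..
qed

text \<open>The even terms of the quotient sequence are \<open>p j \<otimes> inv (q j)\<close>, and
  by invariance each odd term lies at distance \<open>d (a j) (b j)\<close> from the even term
  before it. Interleaving thus merges two conditions into the convergence of one sequence.\<close>

lemma interleaved_quotients_converge_iff: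
  assumes G: "range p \<subseteq> carrier G" "range q \<subseteq> carrier G" "range a \<subseteq> carrier G" "range b \<subseteq> carrier G"
  defines "P \<equiv> \<lambda>j. if even j then p (j div 2) else p (j div 2) \<otimes> a (j div 2)"
    and "Q \<equiv> \<lambda>j. if even j then q (j div 2) else q (j div 2) \<otimes> b (j div 2)"
  shows "(\<exists>l. limitin mtopology (\<lambda>j. P j \<otimes> inv (Q j)) l sequentially) \<longleftrightarrow>
    (\<exists>l. limitin mtopology (\<lambda>j. p j \<otimes> inv (q j)) l sequentially) \<and> (\<lambda>j. d (a j) (b j)) \<longlonglongrightarrow> 0"
proof -
  define w where "w j = P j \<otimes> inv (Q j)" for j
  define z where "z j = p j \<otimes> inv (q j)" for j
  have mem [simp]: "p j \<in> carrier G" "q j \<in> carrier G" "a j \<in> carrier G" "b j \<in> carrier G" for j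
    using G by auto
  have zG [simp]: "z j \<in> carrier G" for j by (simp add: z_def)
  have wG [simp]: "w j \<in> carrier G" for j by (simp add: w_def P_def Q_def)
  have even_w: "w (2 * j) = z j" for j
    by (simp add: w_def z_def P_def Q_def)
  have odd_w: "d (w (2 * j + 1)) (z j) = d (a j) (b j)" for j
  proof -
    \<comment> \<open>Both products are bracketed around a middle factor, which is
      \<open>\<one>\<close> for \<open>z j\<close>, so that \<open>p j\<close> and
      \<open>inv (q j)\<close> cancel by invariance.\<close>
    have "w (2 * j + 1) = p j \<otimes> ((a j \<otimes> inv (b j)) \<otimes> inv (q j))"
      by (simp add: w_def P_def Q_def inv_mult_group m_assoc)
    moreover have "z j = p j \<otimes> (\<one> \<otimes> inv (q j))"
      by (simp add: z_def)
    ultimately have "d (w (2 * j + 1)) (z j) = d (a j \<otimes> inv (b j)) \<one>"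
      by (simp only: left_invariant right_invariant mem inv_closed m_closed one_closed)
    then show ?thesis by (simp add: dist_div_one)
  qed
  have "(\<exists>l. limitin mtopology w l sequentially) \<longleftrightarrow>
      (\<exists>l. limitin mtopology z l sequentially) \<and> (\<lambda>j. d (a j) (b j)) \<longlonglongrightarrow> 0"
  proof (intro iffI conjI; (elim exE conjE)?)
    fix l assume "limitin mtopology w l sequentially"
    then have l: "l \<in> carrier G" "(\<lambda>j. d (w j) l) \<longlonglongrightarrow> 0"
      by (auto simp: limitin_metric_dist_null)
    have ev: "(\<lambda>j. d (z j) l) \<longlonglongrightarrow> 0"
      using LIMSEQ_subseq_LIMSEQ[OF l(2), of "\<lambda>j. 2 * j"]
      by (simp add: o_def even_w strict_mono_def)
    then show "\<exists>l. limitin mtopology z l sequentially"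
      using l by (auto simp: limitin_metric_dist_null)
    have od: "(\<lambda>j. d (w (2 * j + 1)) l) \<longlonglongrightarrow> 0"
      using LIMSEQ_subseq_LIMSEQ[OF l(2), of "\<lambda>j. 2 * j + 1"]
      by (simp add: o_def strict_mono_def)
    show "(\<lambda>j. d (a j) (b j)) \<longlonglongrightarrow> 0"
    proof (rule tendsto_sandwich[OF _ _ tendsto_const])
      show "(\<lambda>j. d (w (2 * j + 1)) l + d (z j) l) \<longlonglongrightarrow> 0"
        using tendsto_add[OF od ev] by simp
      show "\<forall>\<^sub>F j in sequentially. d (a j) (b j) \<le> d (w (2 * j + 1)) l + d (z j) l"
        using triangle'[OF wG l(1) zG] by (intro always_eventually allI) (metis odd_w)
    qed simp
  next
    fix l assume "limitin mtopology z l sequentially" and ab: "(\<lambda>j. d (a j) (b j)) \<longlonglongrightarrow> 0"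
    then have l: "l \<in> carrier G" "(\<lambda>j. d (z j) l) \<longlonglongrightarrow> 0"
      by (auto simp: limitin_metric_dist_null)
    have "(\<lambda>j. d (a j) (b j) + d (z j) l) \<longlonglongrightarrow> 0"
      using tendsto_add[OF ab l(2)] by simp
    then have lim: "(\<lambda>j. d (a (j div 2)) (b (j div 2)) + d (z (j div 2)) l) \<longlonglongrightarrow> 0"
      by (rule filterlim_compose) (rule filterlim_at_top_div_const_nat, simp)
    have "d (w j) l \<le> d (a (j div 2)) (b (j div 2)) + d (z (j div 2)) l" for j
    proof (cases "even j")
      case True
      then show ?thesis by (auto elim!: evenE simp: even_w)
    next
      case False
      then obtain i where i: "j = 2 * i + 1" by (elim oddE)
      then show ?thesis
        using triangle[OF wG zG l(1), of j i] odd_w[of i] by simp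
    qed
    then have "(\<lambda>j. d (w j) l) \<longlonglongrightarrow> 0"
      by (intro tendsto_sandwich[OF _ _ tendsto_const lim] always_eventually) auto
    with l show "\<exists>l. limitin mtopology w l sequentially"
      by (auto simp: limitin_metric_dist_null)
  qed
  then show ?thesis
    unfolding w_def[abs_def] z_def[abs_def] .
qed

end

section \<open>The quotient metric\<close>

text \<open>Closedness of \<open>H\<close> makes distinct cosets have positive distance.\<close>

locale invariant_metric_quotient = invariant_metric_group G d + normal H G
  for G :: "('a, 'b) monoid_scheme" (structure) and d :: "'a \<Rightarrow> 'a \<Rightarrow> real" and H :: "'a set" +
  assumes closedin_subgroup: "closedin mtopology H"
begin

text \<open>The case distinction only avoids the unspecified value \<open>Inf {}\<close>, since \<^locale>\<open>Metric_space\<close> demands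
  nonnegativity off the carrier as well.\<close>
definition coset_dist :: "'a set \<Rightarrow> 'a set \<Rightarrow> real" where
  "coset_dist A B = (if A = {} \<or> B = {} then 0 else Inf {d a b |a b. a \<in> A \<and> b \<in> B})"

lemma r_coset_absorb: "\<lbrakk>h \<in> H; x \<in> carrier G\<rbrakk> \<Longrightarrow> H #> (h \<otimes> x) = H #> x"
  using repr_independence[of "h \<otimes> x" H x] rcosI subset is_subgroup by metis

text \<open>Replaces the infimum over two cosets by a single witness: left multiplication by
  \<open>inv k\<close> moves the freedom in the second coset into the first.\<close>

lemma coset_dist_less_iff:
  assumes a: "a \<in> carrier G" and b: "b \<in> carrier G"
  shows "coset_dist (H #> a) (H #> b) < r \<longleftrightarrow> (\<exists>h\<in>H. d (h \<otimes> a) b < r)"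
proof -
  have ne: "H #> a \<noteq> {}" "H #> b \<noteq> {}"
    using a b is_subgroup rcos_self by blast+
  define S where "S = {d u v |u v. u \<in> H #> a \<and> v \<in> H #> b}"
  have "S \<noteq> {}" using ne by (auto simp: S_def)
  moreover have "bdd_below S"
    by (rule bdd_belowI[of _ 0]) (auto simp: S_def)
  ultimately have "Inf S < r \<longleftrightarrow> (\<exists>s\<in>S. s < r)"
    by (rule cInf_less_iff)
  also have "\<dots> \<longleftrightarrow> (\<exists>h\<in>H. d (h \<otimes> a) b < r)"
  proof
    assume "\<exists>s\<in>S. s < r"
    then obtain h k where hk: "h \<in> H" "k \<in> H" "d (h \<otimes> a) (k \<otimes> b) < r"
      by (auto simp: S_def r_coset_def)
    then have "d (inv k \<otimes> h \<otimes> a) b < r"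
      using left_invariant[of "inv k" "h \<otimes> a" "k \<otimes> b"] a b
      by (simp add: m_assoc[symmetric])
    with hk show "\<exists>h\<in>H. d (h \<otimes> a) b < r"
      by (intro bexI[of _ "inv k \<otimes> h"]) auto
  next
    assume "\<exists>h\<in>H. d (h \<otimes> a) b < r"
    then show "\<exists>s\<in>S. s < r"
      unfolding S_def using a b rcos_self[OF b is_subgroup] rcosI[OF _ subset a] by blast
  qed
  finally show ?thesis
    using ne by (simp add: coset_dist_def S_def)
qed

lemma coset_dist_le:
  assumes "a \<in> carrier G" "b \<in> carrier G"
  shows "coset_dist (H #> a) (H #> b) \<le> d a b"
proof (rule dense_ge)
  fix r assume "d a b < r"
  then show "coset_dist (H #> a) (H #> b) \<le> r"
    using coset_dist_less_iff[OF assms, of r] assms one_closed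
    by (metis l_one less_imp_le subgroup.one_closed is_subgroup)
qed

text \<open>Normality enters here: conjugating a witness \<open>h\<close> by \<open>g\<close> gives
  a witness for the translated cosets. The inequality suffices, since translating back by
  \<open>inv g\<close> yields the reverse one.\<close>

lemma coset_dist_left_le:
  assumes "g \<in> carrier G" "a \<in> carrier G" "b \<in> carrier G"
  shows "coset_dist (H #> (g \<otimes> a)) (H #> (g \<otimes> b)) \<le> coset_dist (H #> a) (H #> b)"
proof (rule dense_ge)
  fix r assume "coset_dist (H #> a) (H #> b) < r"
  then obtain h where h: "h \<in> H" "d (h \<otimes> a) b < r"
    using assms by (auto simp: coset_dist_less_iff)
  have "g \<otimes> h \<otimes> inv g \<in> H"
    using assms h by (simp add: inv_op_closed2)
  moreover have "g \<otimes> h \<otimes> inv g \<otimes> (g \<otimes> a) = g \<otimes> (h \<otimes> a)"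
    using assms h by (simp add: m_assoc) (simp add: m_assoc[symmetric])
  ultimately have "coset_dist (H #> (g \<otimes> a)) (H #> (g \<otimes> b)) < r"
    using assms h by (auto simp: coset_dist_less_iff left_invariant intro!: bexI[of _ "g \<otimes> h \<otimes> inv g"])
  then show "coset_dist (H #> (g \<otimes> a)) (H #> (g \<otimes> b)) \<le> r" by simp
qed

lemma coset_dist_right_le:
  assumes "g \<in> carrier G" "a \<in> carrier G" "b \<in> carrier G"
  shows "coset_dist (H #> (a \<otimes> g)) (H #> (b \<otimes> g)) \<le> coset_dist (H #> a) (H #> b)"
proof (rule dense_ge)
  fix r assume "coset_dist (H #> a) (H #> b) < r"
  then obtain h where h: "h \<in> H" "d (h \<otimes> a) b < r"
    using assms by (auto simp: coset_dist_less_iff)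
  moreover have "d (h \<otimes> (a \<otimes> g)) (b \<otimes> g) = d (h \<otimes> a) b"
    using assms h by (simp add: m_assoc[symmetric] right_invariant)
  ultimately have "coset_dist (H #> (a \<otimes> g)) (H #> (b \<otimes> g)) < r"
    using assms by (auto simp: coset_dist_less_iff intro!: bexI[of _ h])
  then show "coset_dist (H #> (a \<otimes> g)) (H #> (b \<otimes> g)) \<le> r" by simp
qed

lemma Metric_space_coset_dist: "Metric_space (carrier (G Mod H)) coset_dist"
proof
  show "0 \<le> coset_dist A B" for A B
    by (auto simp: coset_dist_def intro!: cInf_greatest)
  have "{d a b |a b. a \<in> A \<and> b \<in> B} = {d a b |a b. a \<in> B \<and> b \<in> A}" for A B
    using commute by blast
  then show "coset_dist A B = coset_dist B A" for A B
    by (auto simp: coset_dist_def)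
next
  fix A B assume "A \<in> carrier (G Mod H)" "B \<in> carrier (G Mod H)"
  then obtain a b where a: "a \<in> carrier G" "A = H #> a" and b: "b \<in> carrier G" "B = H #> b"
    by (auto simp: carrier_FactGroup)
  show "coset_dist A B = 0 \<longleftrightarrow> A = B"
  proof
    assume 0: "coset_dist A B = 0"
    \<comment> \<open>Distance zero puts \<open>b \<otimes> inv a\<close> in the closure of
      \<open>H\<close>, which is \<open>H\<close> itself, and then the cosets agree.\<close>
    have "\<exists>y\<in>H. y \<in> mball (b \<otimes> inv a) r" if r: "0 < r" for r
    proof -
      obtain h where h: "h \<in> H" "d (h \<otimes> a) b < r"
        using coset_dist_less_iff[OF a(1) b(1), of r] 0 a b r by auto
      have "d h (b \<otimes> inv a) = d (h \<otimes> a) b"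
        using right_invariant[of a h "b \<otimes> inv a"] a b h by (simp add: m_assoc)
      with h a b show ?thesis
        by (intro bexI[of _ h]) (simp_all add: commute[of "b \<otimes> inv a"])
    qed
    then have "b \<otimes> inv a \<in> mtopology closure_of H"
      using a b by (simp add: metric_closure_of)
    then have "b \<otimes> inv a \<in> H"
      using closedin_subgroup closure_of_closedin by blast
    from r_coset_absorb[OF this a(1)] show "A = B"
      using a b by (simp add: m_assoc)
  next
    assume "A = B"
    then have "coset_dist A B \<le> 0"
      using coset_dist_le[of a a] a by simp
    moreover have "0 \<le> coset_dist A B"
      by (auto simp: coset_dist_def intro!: cInf_greatest)
    ultimately show "coset_dist A B = 0" by simp
  qed
next
  fix A B C
  assume "A \<in> carrier (G Mod H)" "B \<in> carrier (G Mod H)" "C \<in> carrier (G Mod H)"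
  then obtain a b c where abc: "a \<in> carrier G" "A = H #> a" "b \<in> carrier G" "B = H #> b"
      "c \<in> carrier G" "C = H #> c"
    by (auto simp: carrier_FactGroup)
  show "coset_dist A C \<le> coset_dist A B + coset_dist B C"
  proof (rule field_le_epsilon)
    fix e :: real assume "0 < e"
    then obtain h k where h: "h \<in> H" "d (h \<otimes> a) b < coset_dist A B + e / 2"
      and k: "k \<in> H" "d (k \<otimes> b) c < coset_dist B C + e / 2"
      using abc coset_dist_less_iff[of a b "coset_dist A B + e / 2"]
        coset_dist_less_iff[of b c "coset_dist B C + e / 2"] by auto
    \<comment> \<open>The product \<open>k \<otimes> h\<close> of the two witnesses is a witness for
      the outer cosets.\<close>
    have "d (k \<otimes> h \<otimes> a) c \<le> d (k \<otimes> (h \<otimes> a)) (k \<otimes> b) + d (k \<otimes> b) c"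
      using abc h k by (simp add: m_assoc triangle)
    also have "\<dots> < coset_dist A B + coset_dist B C + e"
      using abc h k by (simp add: left_invariant)
    finally have "coset_dist A C < coset_dist A B + coset_dist B C + e"
      using abc h k coset_dist_less_iff[of a c] by blast
    then show "coset_dist A C \<le> coset_dist A B + coset_dist B C + e" by simp
  qed
qed

sublocale Q: invariant_metric_group "G Mod H" coset_dist
proof (intro invariant_metric_group.intro invariant_metric_group_axioms.intro
    factorgroup_is_group Metric_space_coset_dist)
  fix C A B assume "C \<in> carrier (G Mod H)" "A \<in> carrier (G Mod H)" "B \<in> carrier (G Mod H)"
  then obtain a b c where abc: "a \<in> carrier G" "A = H #> a" "b \<in> carrier G" "B = H #> b"
      "c \<in> carrier G" "C = H #> c"
    by (auto simp: carrier_FactGroup)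
  have "inv c \<otimes> (c \<otimes> a) = a" "inv c \<otimes> (c \<otimes> b) = b"
    using abc by (simp_all add: m_assoc[symmetric])
  then show "coset_dist (C \<otimes>\<^bsub>G Mod H\<^esub> A) (C \<otimes>\<^bsub>G Mod H\<^esub> B) = coset_dist A B"
    using coset_dist_left_le[of c a b] coset_dist_left_le[of "inv c" "c \<otimes> a" "c \<otimes> b"] abc
    by (simp add: rcos_sum)
  have "(a \<otimes> c) \<otimes> inv c = a" "(b \<otimes> c) \<otimes> inv c = b"
    using abc by (simp_all add: m_assoc)
  then show "coset_dist (A \<otimes>\<^bsub>G Mod H\<^esub> C) (B \<otimes>\<^bsub>G Mod H\<^esub> C) = coset_dist A B"
    using coset_dist_right_le[of c a b] coset_dist_right_le[of "inv c" "a \<otimes> c" "b \<otimes> c"] abc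
    by (simp add: rcos_sum)
qed

lemma r_coset_in_carrier [simp]: "a \<in> carrier G \<Longrightarrow> H #> a \<in> carrier (G Mod H)"
  by (auto simp: carrier_FactGroup)

text \<open>A coset lies within \<open>r\<close> of \<open>H #> x\<close> iff it has a
  representative within \<open>r\<close> of \<open>x\<close>, so the coset map sends balls onto
  balls of equal radius.\<close>

lemma quotient_group_topology_eq: "quotient_group_topology G mtopology H = Q.mtopology"
  unfolding topology_eq
proof (intro allI)
  fix U
  have "(\<forall>A. A \<in> U \<longrightarrow> (\<exists>r>0. Q.mball A r \<subseteq> U)) \<longleftrightarrow>
    (\<forall>x. x \<in> {x \<in> carrier G. H #> x \<in> U} \<longrightarrow> (\<exists>r>0. mball x r \<subseteq> {x \<in> carrier G. H #> x \<in> U}))"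
    (is "?L \<longleftrightarrow> ?R") if U: "U \<subseteq> carrier (G Mod H)"
  proof
    assume ?L
    show ?R
    proof (intro allI impI)
      fix x assume x: "x \<in> {x \<in> carrier G. H #> x \<in> U}"
      then obtain r where r: "0 < r" "Q.mball (H #> x) r \<subseteq> U"
        using \<open>?L\<close> by blast
      have "H #> y \<in> U" if "y \<in> mball x r" for y
      proof -
        have "H #> y \<in> Q.mball (H #> x) r"
          using that coset_dist_le[of x y] by simp
        with r show ?thesis by blast
      qed
      with r(1) show "\<exists>r>0. mball x r \<subseteq> {x \<in> carrier G. H #> x \<in> U}"
        by (intro exI[of _ r]) auto
    qed
  next
    assume ?R
    show ?L
    proof (intro allI impI)
      fix A assume "A \<in> U"
      then obtain x where x: "x \<in> carrier G" "A = H #> x"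
        using U by (auto simp: carrier_FactGroup)
      with \<open>A \<in> U\<close> obtain r where r: "0 < r" "mball x r \<subseteq> {x \<in> carrier G. H #> x \<in> U}"
        using \<open>?R\<close> by blast
      have "B \<in> U" if B: "B \<in> Q.mball A r" for B
      proof -
        obtain y where y: "y \<in> carrier G" "B = H #> y"
          using B unfolding Q.in_mball by (auto simp: carrier_FactGroup)
        with B x obtain h where h: "h \<in> H" "d (h \<otimes> x) y < r"
          by (auto simp: coset_dist_less_iff)
        have "d x (inv h \<otimes> y) = d (h \<otimes> x) y"
          using left_invariant[of h x "inv h \<otimes> y"] x y h by (simp add: m_assoc[symmetric])
        with x y h have "inv h \<otimes> y \<in> mball x r" by simp
        then have "H #> (inv h \<otimes> y) \<in> U" using r by blast
        then show ?thesis
          using y h by (simp add: r_coset_absorb)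
      qed
      with r(1) show "\<exists>r>0. Q.mball A r \<subseteq> U" by blast
    qed
  qed
  then show "openin (quotient_group_topology G mtopology H) U \<longleftrightarrow> openin Q.mtopology U"
    unfolding openin_quotient_group_topology Q.openin_mtopology openin_mtopology topspace_mtopology
    by blast
qed

section \<open>Convergence in the group versus convergence in the quotient\<close>

lemma continuous_map_r_coset: "continuous_map mtopology Q.mtopology (\<lambda>x. H #> x)"
  unfolding Q.continuous_map_to_metric
proof (intro ballI allI impI)
  fix x and e :: real assume x: "x \<in> topspace mtopology" "0 < e"
  have "H #> y \<in> Q.mball (H #> x) e" if "y \<in> mball x e" for y
    using that coset_dist_le[of x y] by simp
  with x show "\<exists>U. openin mtopology U \<and> x \<in> U \<and> (\<forall>y\<in>U. H #> y \<in> Q.mball (H #> x) e)"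
    by (intro exI[of _ "mball x e"]) auto
qed

text \<open>Metric form of the open subgroup base: \<open>V\<close> is small, yet absorbs every
  sufficiently small element of \<open>H\<close>.\<close>

lemma small_open_subgroup:
  assumes "non_archimedean_group (G\<lparr>carrier := H\<rparr>) (subtopology mtopology H)" "0 < e"
  obtains V \<delta> where "subgroup V (G\<lparr>carrier := H\<rparr>)" "\<And>v. v \<in> V \<Longrightarrow> d v \<one> < e"
    "0 < \<delta>" "\<And>h. \<lbrakk>h \<in> H; d h \<one> < \<delta>\<rbrakk> \<Longrightarrow> h \<in> V"
proof -
  have "neighbourhood_base_at \<one> (\<lambda>V. openin (subtopology mtopology H) V \<and> subgroup V (G\<lparr>carrier := H\<rparr>))
      (subtopology mtopology H)"
    using non_archimedean_group.open_subgroup_base[OF assms(1)] by simp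
  moreover have "openin (subtopology mtopology H) (mball \<one> e \<inter> H)"
    by (simp add: openin_subtopology_Int)
  ultimately obtain U V where UV: "openin (subtopology mtopology H) U" "\<one> \<in> U" "U \<subseteq> V"
      "V \<subseteq> mball \<one> e \<inter> H" "subgroup V (G\<lparr>carrier := H\<rparr>)"
    unfolding neighbourhood_base_at_def using assms(2) by auto
  then obtain W where W: "openin mtopology W" "U = W \<inter> H"
    by (auto simp: openin_subtopology)
  then obtain \<delta> where \<delta>: "0 < \<delta>" "mball \<one> \<delta> \<subseteq> W"
    using UV(2) by (auto simp: openin_mtopology)
  show ?thesis
  proof (rule that[OF UV(5) _ \<delta>(1)])
    show "d v \<one> < e" if "v \<in> V" for v
      using UV(4) that by (auto simp: commute)
    show "h \<in> V" if "h \<in> H" "d h \<one> < \<delta>" for h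
    proof -
      have "h \<in> mball \<one> \<delta>"
        using that by (simp add: commute)
      with that \<delta> W UV show ?thesis by blast
    qed
  qed
qed

text \<open>Convergence in the quotient gives correctors \<open>h n\<close> in \<open>H\<close> with
  \<open>h n \<otimes> z n\<close> near a fixed \<open>g\<close>. Small steps of \<open>z\<close>
  make consecutive correctors close, so their quotients fall into one small open subgroup;
  telescoping inside it shows that the single corrector \<open>h N\<close> serves for all later
  \<open>n\<close>. Hence \<open>z\<close> is Cauchy, and completeness applies.\<close>

lemma convergent_iff_quotient_convergent:
  assumes na: "non_archimedean_group (G\<lparr>carrier := H\<rparr>) (subtopology mtopology H)"
    and complete: mcomplete and z: "range z \<subseteq> carrier G"
  shows "(\<exists>l. limitin mtopology z l sequentially) \<longleftrightarrow>
    (\<exists>l. limitin Q.mtopology (\<lambda>n. H #> z n) l sequentially) \<and> (\<lambda>n. d (z n) (z (Suc n))) \<longlonglongrightarrow> 0"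
proof (intro iffI conjI; (elim exE conjE)?)
  have zG [simp]: "z n \<in> carrier G" for n using z by auto
  {
    fix l assume l: "limitin mtopology z l sequentially"
    then show "\<exists>l. limitin Q.mtopology (\<lambda>n. H #> z n) l sequentially"
      using continuous_map_limit[OF continuous_map_r_coset l] by (auto simp: o_def)
    have lG: "l \<in> carrier G" and "(\<lambda>n. d (z n) l) \<longlonglongrightarrow> 0"
      using l by (auto simp: limitin_metric_dist_null)
    then have lim: "(\<lambda>n. d (z n) l + d (z (Suc n)) l) \<longlonglongrightarrow> 0"
      using tendsto_add[of "\<lambda>n. d (z n) l" 0 _ "\<lambda>n. d (z (Suc n)) l" 0] LIMSEQ_Suc by fastforce
    show "(\<lambda>n. d (z n) (z (Suc n))) \<longlonglongrightarrow> 0"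
      using triangle'[OF zG lG zG]
      by (intro tendsto_sandwich[OF _ _ tendsto_const lim] always_eventually) auto
  next
    fix L assume L: "limitin Q.mtopology (\<lambda>n. H #> z n) L sequentially"
      and step: "(\<lambda>n. d (z n) (z (Suc n))) \<longlonglongrightarrow> 0"
    then obtain g where g [simp]: "g \<in> carrier G" and "L = H #> g"
      using Q.limitin_mspace[OF L] by (auto simp: carrier_FactGroup)
    have near: "\<forall>\<^sub>F n in sequentially. \<exists>h\<in>H. d (h \<otimes> z n) g < r" if "0 < r" for r
    proof -
      have "\<forall>\<^sub>F n in sequentially. coset_dist (H #> z n) (H #> g) < r"
        using L that unfolding \<open>L = H #> g\<close> Q.limitin_metric by (auto elim: eventually_mono)
      then show ?thesis by (simp add: coset_dist_less_iff)
    qed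
    have "MCauchy z"
      unfolding MCauchy_def
    proof (intro conjI allI impI z)
      fix e :: real assume "0 < e"
      then obtain V \<delta> where V: "subgroup V (G\<lparr>carrier := H\<rparr>)" "\<And>v. v \<in> V \<Longrightarrow> d v \<one> < e / 6"
        and \<delta>: "0 < \<delta>" "\<And>h. \<lbrakk>h \<in> H; d h \<one> < \<delta>\<rbrakk> \<Longrightarrow> h \<in> V"
        using small_open_subgroup[OF na, of "e / 6"] by auto
      \<comment> \<open>Three terms below \<open>r\<close> bound the distance between consecutive
        correctors, hence \<open>\<delta> / 3\<close>; the bound \<open>e / 6\<close> keeps the
        final estimate below \<open>e / 2\<close>.\<close>
      define r where "r = min (\<delta> / 3) (e / 6)"
      have r: "0 < r" "3 * r \<le> \<delta>" "r \<le> e / 6"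
        using \<delta> \<open>0 < e\<close> by (auto simp: r_def)
      have "\<forall>\<^sub>F n in sequentially. (\<exists>h\<in>H. d (h \<otimes> z n) g < r) \<and> d (z n) (z (Suc n)) < r"
        using near[OF r(1)] order_tendstoD(2)[OF step r(1)] by (rule eventually_conj)
      then obtain N where N: "\<And>n. n \<ge> N \<Longrightarrow> \<exists>h\<in>H. d (h \<otimes> z n) g < r"
          "\<And>n. n \<ge> N \<Longrightarrow> d (z n) (z (Suc n)) < r"
        unfolding eventually_sequentially by blast
      then obtain h where h: "\<And>n. n \<ge> N \<Longrightarrow> h n \<in> H" "\<And>n. n \<ge> N \<Longrightarrow> d (h n \<otimes> z n) g < r"
        by metis
      have succ: "h n \<otimes> inv (h (Suc n)) \<in> V" if "n \<ge> N" for n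
      proof (rule \<delta>(2))
        have hn [simp]: "h n \<in> H" "h (Suc n) \<in> H" using h(1) that by auto
        then show "h n \<otimes> inv h (Suc n) \<in> H" by simp
        have "d (h n) (h (Suc n)) = d (h n \<otimes> z n) (h (Suc n) \<otimes> z n)"
          by (simp add: right_invariant)
        also have "\<dots> \<le> d (h n \<otimes> z n) g + d (h (Suc n) \<otimes> z n) g"
          by (intro triangle') auto
        also have "d (h (Suc n) \<otimes> z n) g \<le>
            d (h (Suc n) \<otimes> z n) (h (Suc n) \<otimes> z (Suc n)) + d (h (Suc n) \<otimes> z (Suc n)) g"
          by (intro triangle) auto
        also have "d (h (Suc n) \<otimes> z n) (h (Suc n) \<otimes> z (Suc n)) = d (z n) (z (Suc n))"
          by (simp add: left_invariant)
        finally have "d (h n) (h (Suc n)) < 3 * r"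
          using h(2)[of n] h(2)[of "Suc n"] N(2)[of n] that by linarith
        with r show "d (h n \<otimes> inv h (Suc n)) \<one> < \<delta>"
          by (simp add: dist_div_one)
      qed
      \<comment> \<open>Membership in the subgroup \<open>V\<close> does not deteriorate along the telescoping product.\<close>
      have telescope: "h N \<otimes> inv (h n) \<in> V" if "n \<ge> N" for n
        using that
      proof (induction n rule: dec_induct)
        case base
        then show ?case
          using h(1)[of N] subgroup.one_closed[OF V(1)] by simp
      next
        case (step n)
        have hn [simp]: "h N \<in> H" "h n \<in> H" "h (Suc n) \<in> H"
          using h(1) step.hyps by auto
        have "(h N \<otimes> inv (h n)) \<otimes> (h n \<otimes> inv (h (Suc n))) = h N \<otimes> inv (h (Suc n))"
          using hn[THEN mem_carrier] by (simp add: m_assoc inv_solve_left')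
        moreover have "(h N \<otimes> inv (h n)) \<otimes> (h n \<otimes> inv (h (Suc n))) \<in> V"
          using subgroup.m_closed[OF V(1) step.IH succ[of n]] step.hyps by simp
        ultimately show ?case by simp
      qed
      \<comment> \<open>Replacing \<open>h n\<close> by \<open>h N\<close> costs less than
        \<open>e / 6\<close>, uniformly in \<open>n\<close>.\<close>
      have close: "d (z n) (inv (h N) \<otimes> g) < e / 2" if "n \<ge> N" for n
      proof -
        have hn [simp]: "h N \<in> H" "h n \<in> H"
          using h(1) that by auto
        have "d (h N) (h n) < e / 6"
          using V(2)[OF telescope[OF that]] by (simp add: dist_div_one)
        moreover have "d (z n) (inv (h N) \<otimes> g) = d (h N \<otimes> z n) g"
          using left_invariant[of "h N" "z n" "inv (h N) \<otimes> g"] by (simp add: m_assoc[symmetric])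
        moreover have "d (h N \<otimes> z n) g \<le> d (h N \<otimes> z n) (h n \<otimes> z n) + d (h n \<otimes> z n) g"
          by (intro triangle) auto
        ultimately show ?thesis
          using h(2)[OF that] r by (simp add: right_invariant)
      qed
      have "d (z n) (z n') < e" if "N \<le> n" "N \<le> n'" for n n'
        using triangle'[of "z n" "inv (h N) \<otimes> g" "z n'"] close[OF that(1)] close[OF that(2)] h(1)[of N]
        by simp
      then show "\<exists>N. \<forall>n n'. N \<le> n \<longrightarrow> N \<le> n' \<longrightarrow> d (z n) (z n') < e" by blast
    qed
    then show "\<exists>l. limitin mtopology z l sequentially"
      using complete by (simp add: mcomplete_def)
  }
qed

end

section \<open>The reduction\<close>

lemma continuous_map_imp_borel_measurable:
  assumes "continuous_map X Y f"
  shows "f \<in> borel_of_topology X \<rightarrow>\<^sub>M borel_of_topology Y"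
  unfolding borel_of_topology_def
proof (rule measurable_measure_of)
  show "{U. openin Y U} \<subseteq> Pow (topspace Y)"
    by (auto dest: openin_subset)
  have X: "{U. openin X U} \<subseteq> Pow (topspace X)"
    by (auto dest: openin_subset)
  show "f \<in> space (sigma (topspace X) {U. openin X U}) \<rightarrow> topspace Y"
    using assms by (simp add: space_measure_of[OF X] continuous_map_def)
  fix U assume "U \<in> {U. openin Y U}"
  then have "openin X {x \<in> topspace X. f x \<in> U}"
    using assms by (simp add: continuous_map_def)
  moreover have "f -` U \<inter> space (sigma (topspace X) {U. openin X U}) = {x \<in> topspace X. f x \<in> U}"
    by (auto simp: space_measure_of[OF X])
  ultimately show "f -` U \<inter> space (sigma (topspace X) {U. openin X U}) \<in> sets (sigma (topspace X) {U. openin X U})"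
    by (simp add: sets_measure_of[OF X] sigma_sets.Basic)
qed

lemma topspace_sequence_topology: "topspace (sequence_topology T) = {x. range x \<subseteq> topspace T}"
  by (auto simp: sequence_topology_def)

lemma continuous_map_sequence_topology_nth:
  "continuous_map (sequence_topology T) T (\<lambda>x. x n)"
  unfolding sequence_topology_def by (rule continuous_map_product_projection) simp

lemma (in invariant_metric_quotient) borel_reducible_quotient:
  assumes na: "non_archimedean_group (G\<lparr>carrier := H\<rparr>) (subtopology mtopology H)"
    and separable: "separable_space mtopology" and complete: mcomplete
    and f: "continuous_map (top_of_set {0..1::real}) Q.mtopology f" "inj_on f {0..1}"
  shows "borel_reducible (sequence_topology mtopology) (E_rel G mtopology)
    (sequence_topology Q.mtopology) (E_rel (G Mod H) Q.mtopology)"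
proof -
  obtain \<nu> :: "nat \<Rightarrow> nat" and \<Phi> :: "nat \<Rightarrow> 'a \<Rightarrow> real"
    where \<Phi>: "\<And>j u. \<Phi> j u \<in> {0..1}"
      "\<And>j u v. \<lbrakk>u \<in> carrier G; v \<in> carrier G\<rbrakk> \<Longrightarrow> \<bar>\<Phi> j u - \<Phi> j v\<bar> \<le> d u v"
      "\<And>u v. \<lbrakk>range u \<subseteq> carrier G; range v \<subseteq> carrier G\<rbrakk> \<Longrightarrow>
        ((\<lambda>j. \<Phi> j (u (\<nu> j)) - \<Phi> j (v (\<nu> j))) \<longlonglongrightarrow> 0) \<longleftrightarrow> ((\<lambda>n. d (u n) (v n)) \<longlonglongrightarrow> 0)"
    by (rule c0_coding[OF separable]) (rule that)
  \<comment> \<open>By \<open>dist_div_div\<close>, consecutive terms of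
    \<open>x n \<otimes> inv (y n)\<close> have distance \<open>d (u x n) (u y n)\<close>. So
    \<open>u x\<close> holds all that the step condition needs from \<open>x\<close>, and
    \<open>\<theta> x\<close> depends on \<open>x\<close> alone.\<close>
  define u where "u x n = inv (x (Suc n)) \<otimes> x n" for x :: "nat \<Rightarrow> 'a" and n
  define t where "t x j = \<Phi> j (u x (\<nu> j))" for x j
  define \<theta> where "\<theta> x j = (if even j then H #> x (j div 2)
      else (H #> x (j div 2)) \<otimes>\<^bsub>G Mod H\<^esub> f (t x (j div 2)))" for x j
  let ?S = "sequence_topology mtopology"
  have fK: "f s \<in> carrier (G Mod H)" if "s \<in> {0..1}" for s
    using f(1) that by (auto simp: continuous_map_def)
  have tI: "t x j \<in> {0..1}" for x j
    unfolding t_def by (rule \<Phi>(1))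
  \<comment> \<open>The Lipschitz bound gives continuity; together with continuity of the coset map
    and of \<open>f\<close> it makes every coordinate of \<open>\<theta>\<close> continuous.\<close>
  have cont_\<Phi>: "continuous_map mtopology euclidean (\<Phi> j)" for j
    unfolding mtopology_is_euclidean[symmetric] Met_TC.continuous_map_to_metric
  proof (intro ballI allI impI)
    fix w and e :: real assume "w \<in> topspace mtopology" "0 < e"
    then show "\<exists>U. openin mtopology U \<and> w \<in> U \<and> (\<forall>y\<in>U. \<Phi> j y \<in> Met_TC.mball (\<Phi> j w) e)"
      using \<Phi>(2)[of w _ j]
      by (intro exI[of _ "mball w e"]) (force simp: dist_real_def)
  qed
  have cont_coset: "continuous_map ?S Q.mtopology (\<lambda>x. H #> x n)" for n
    using continuous_map_compose[OF continuous_map_sequence_topology_nth continuous_map_r_coset]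
    by (simp add: o_def)
  have cont_t: "continuous_map ?S (top_of_set {0..1}) (\<lambda>x. t x j)" for j
  proof -
    have "continuous_map ?S mtopology (\<lambda>x. u x (\<nu> j))"
      unfolding u_def
      by (intro continuous_map_mult continuous_map_inverse continuous_map_sequence_topology_nth)
    from continuous_map_compose[OF this cont_\<Phi>[of j]] show ?thesis
      using tI by (auto simp: continuous_map_in_subtopology o_def t_def)
  qed
  have cont_\<theta>: "continuous_map ?S (sequence_topology Q.mtopology) \<theta>"
    unfolding sequence_topology_def[of Q.mtopology] continuous_map_componentwise_UNIV
  proof
    fix j
    show "continuous_map ?S Q.mtopology (\<lambda>x. \<theta> x j)"
    proof (cases "even j")
      case True
      then show ?thesis by (simp add: \<theta>_def cont_coset)
    next
      case False
      have "continuous_map ?S Q.mtopology (\<lambda>x. f (t x (j div 2)))"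
        using continuous_map_compose[OF cont_t f(1)] by (simp add: o_def)
      from Q.continuous_map_mult[OF cont_coset this] False show ?thesis
        by (simp add: \<theta>_def)
    qed
  qed
  then have \<theta>_in: "\<theta> x \<in> topspace (sequence_topology Q.mtopology)" if "x \<in> topspace ?S" for x
    using that by (auto simp: continuous_map_def)
  have "(x, y) \<in> E_rel G mtopology \<longleftrightarrow> (\<theta> x, \<theta> y) \<in> E_rel (G Mod H) Q.mtopology"
    if xy: "x \<in> topspace ?S" "y \<in> topspace ?S" for x y
  proof -
    have mem [simp]: "x n \<in> carrier G" "y n \<in> carrier G" for n
      using xy by (auto simp: topspace_sequence_topology)
    define z where "z n = x n \<otimes> inv (y n)" for n
    have coset_z: "H #> z n = (H #> x n) \<otimes>\<^bsub>G Mod H\<^esub> inv\<^bsub>G Mod H\<^esub> (H #> y n)" for n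
      by (simp add: z_def inv_FactGroup rcos_inv rcos_sum)
    have dz: "d (z n) (z (Suc n)) = d (u x n) (u y n)" for n
      by (simp add: z_def u_def dist_div_div)
    \<comment> \<open>Convergence of \<open>z\<close> splits into quotient convergence and vanishing
      steps; the steps are coded in \<open>[0,1]\<close>, carried along the arc into the quotient,
      and merged with the first condition by interleaving.\<close>
    have "(x, y) \<in> E_rel G mtopology \<longleftrightarrow> (\<exists>l. limitin mtopology z l sequentially)"
      using xy by (simp add: E_rel_def z_def[abs_def])
    also have "\<dots> \<longleftrightarrow> (\<exists>l. limitin Q.mtopology (\<lambda>n. H #> z n) l sequentially) \<and>
        (\<lambda>n. d (u x n) (u y n)) \<longlonglongrightarrow> 0"
      unfolding dz[symmetric]
      by (rule convergent_iff_quotient_convergent[OF na complete]) (auto simp: z_def)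
    also have "(\<lambda>n. d (u x n) (u y n)) \<longlonglongrightarrow> 0 \<longleftrightarrow> (\<lambda>j. t x j - t y j) \<longlonglongrightarrow> 0"
      unfolding t_def by (rule \<Phi>(3)[symmetric]) (auto simp: u_def)
    also have "\<dots> \<longleftrightarrow> (\<lambda>j. coset_dist (f (t x j)) (f (t y j))) \<longlonglongrightarrow> 0"
      using tI by (intro Q.arc_mdist_tendsto_0_iff[OF f, symmetric]) auto
    also have "(\<exists>l. limitin Q.mtopology (\<lambda>n. H #> z n) l sequentially) \<and>
        (\<lambda>j. coset_dist (f (t x j)) (f (t y j))) \<longlonglongrightarrow> 0 \<longleftrightarrow>
      (\<exists>l. limitin Q.mtopology (\<lambda>j. \<theta> x j \<otimes>\<^bsub>G Mod H\<^esub> inv\<^bsub>G Mod H\<^esub> (\<theta> y j)) l sequentially)"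
      unfolding coset_z \<theta>_def
      by (rule Q.interleaved_quotients_converge_iff[symmetric]) (auto intro!: fK tI)
    also have "\<dots> \<longleftrightarrow> (\<theta> x, \<theta> y) \<in> E_rel (G Mod H) Q.mtopology"
      using \<theta>_in[OF xy(1)] \<theta>_in[OF xy(2)] by (simp add: E_rel_def)
    finally show ?thesis .
  qed
  with continuous_map_imp_borel_measurable[OF cont_\<theta>] show ?thesis
    unfolding borel_reducible_def by blast
qed

theorem theorem6p5:
  fixes G :: "('a, 'b) monoid_scheme" and T :: "'a topology" and H :: "'a set"
  assumes "tsi_polish_group G T"
    and "H \<lhd> G" and "closedin T H"
    and "non_archimedean_group (G\<lparr>carrier := H\<rparr>) (subtopology T H)"
    and "\<exists>f. embedding_map (top_of_set {0..1::real}) (quotient_group_topology G T H) f"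
  shows "borel_reducible
    (sequence_topology T) (E_rel G T)
    (sequence_topology (quotient_group_topology G T H))
    (E_rel (G Mod H) (quotient_group_topology G T H))"
proof -
  interpret tsi_polish_group G T by fact
  obtain d where d: "Metric_space (carrier G) d" "Metric_space.mtopology (carrier G) d = T"
    and inv: "\<And>g h x y. \<lbrakk>g \<in> carrier G; h \<in> carrier G; x \<in> carrier G; y \<in> carrier G\<rbrakk> \<Longrightarrow>
        d (g \<otimes>\<^bsub>G\<^esub> x \<otimes>\<^bsub>G\<^esub> h) (g \<otimes>\<^bsub>G\<^esub> y \<otimes>\<^bsub>G\<^esub> h) = d x y"
    using two_sided_invariant_metric by blast
  have "invariant_metric_group G d"
  proof (intro invariant_metric_group.intro invariant_metric_group_axioms.intro is_group d(1))
    show "d (g \<otimes>\<^bsub>G\<^esub> x) (g \<otimes>\<^bsub>G\<^esub> y) = d x y"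
      if "g \<in> carrier G" "x \<in> carrier G" "y \<in> carrier G" for g x y
      using inv[of g "\<one>\<^bsub>G\<^esub>" x y] that by simp
    show "d (x \<otimes>\<^bsub>G\<^esub> g) (y \<otimes>\<^bsub>G\<^esub> g) = d x y"
      if "g \<in> carrier G" "x \<in> carrier G" "y \<in> carrier G" for g x y
      using inv[of "\<one>\<^bsub>G\<^esub>" g x y] that by simp
  qed
  with assms(2,3) d interpret Q: invariant_metric_quotient G d H
    by (intro invariant_metric_quotient.intro invariant_metric_quotient_axioms.intro) auto
  note T = d(2)[symmetric]
  have quot: "quotient_group_topology G T H = Q.Q.mtopology"
    unfolding T by (rule Q.quotient_group_topology_eq)
  obtain f where "embedding_map (top_of_set {0..1::real}) Q.Q.mtopology f"
    using assms(5) unfolding quot by blast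
  then have "continuous_map (top_of_set {0..1::real}) Q.Q.mtopology f" "inj_on f {0..1}"
    by (auto simp: embedding_map_def homeomorphic_eq_everything_map continuous_map_in_subtopology)
  \<comment> \<open>Polishness provides some complete metric for \<open>T\<close>; the Baire
    argument transfers completeness to the invariant metric \<open>d\<close>.\<close>
  moreover have "Q.mcomplete"
    using completely_metrizable unfolding T by (rule Q.completely_metrizable_imp_mcomplete)
  ultimately show ?thesis
    using Q.borel_reducible_quotient assms(4) separable unfolding quot unfolding T by blast
qed

end
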